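(* A stick is broken at random into three pieces of lengths $\alpha,\beta,\gamma$. The probability that there exists an acute triangle with side lengths $\alpha,\beta,\gamma$ is equal to $\ln(8/e^2)=3\ln 2-2$.
   Context: Probabilistic model (broken stick): the stick has length $\sqrt3$. Let $T$ be the equilateral triangle with vertices $(1,0)$, $(-1,0)$, $(0,\sqrt3)$ (side length $2$, area $\sqrt3$). A point $Q=(x,y)$ is chosen uniformly at random (with respect to area) inside $T$, and the three pieces are the distances from $Q$ to the three sides of $T$: $$\alpha=y,\qquad \beta=\frac{\sqrt3(1+x)-y}{2},\qquad \gamma=\frac{\sqrt3(1-x)-y}{2},$$ so that $\alpha+\beta+\gamma=\sqrt3$. The probability of an event described by a region $\mathcal R\subseteq T$ is $\mathrm{Area}(\mathcal R)/\sqrt3$. Triangles are non-degenerate. The probability in the claim is the unconditional one (the triangle exists and is acute). *)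

theory Defs
  imports "HOL-Analysis.Analysis"
begin

definition angle_at :: "'a::real_inner \<Rightarrow> 'a \<Rightarrow> 'a \<Rightarrow> real" where
  "angle_at B A C = arccos (((A - B) \<bullet> (C - B)) / (norm (A - B) * norm (C - B)))"

definition acute_triangle :: "real \<times> real \<Rightarrow> real \<times> real \<Rightarrow> real \<times> real \<Rightarrow> bool" where
  "acute_triangle A B C \<longleftrightarrow>
     \<not> collinear {A, B, C} \<and>
     angle_at A B C < pi / 2 \<and> angle_at B C A < pi / 2 \<and> angle_at C A B < pi / 2"

definition exists_acute_triangle :: "real \<Rightarrow> real \<Rightarrow> real \<Rightarrow> bool" where
  "exists_acute_triangle a b c \<longleftrightarrow>
     (\<exists>A B C. acute_triangle A B C \<and> dist B C = a \<and> dist C A = b \<and> dist A B = c)"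

definition stick_triangle :: "(real \<times> real) set" where
  "stick_triangle = convex hull {(1, 0), (-1, 0), (0, sqrt 3)}"

text \<open>
  A point of the equilateral triangle encodes a way of breaking a stick of length \<open>sqrt 3\<close>:
  the pieces are its distances to the three sides (Viviani).
\<close>

definition piece_alpha :: "real \<times> real \<Rightarrow> real" where
  "piece_alpha Q = infdist Q (closed_segment (-1, 0) (1, 0))"

definition piece_beta :: "real \<times> real \<Rightarrow> real" where
  "piece_beta Q = infdist Q (closed_segment (-1, 0) (0, sqrt 3))"

definition piece_gamma :: "real \<times> real \<Rightarrow> real" where
  "piece_gamma Q = infdist Q (closed_segment (1, 0) (0, sqrt 3))"

lemma stick_triangle_ineqs:
  assumes "(x, y) \<in> stick_triangle"
  shows "0 \<le> y" "y \<le> sqrt 3 * (1 + x)" "y \<le> sqrt 3 * (1 - x)"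
proof -
  obtain u v w :: real where "0 \<le> u" "0 \<le> v" "0 \<le> w" "u + v + w = 1"
    and "(x, y) = u *\<^sub>R (1, 0) + v *\<^sub>R (-1, 0) + w *\<^sub>R (0, sqrt 3)"
    using assms unfolding stick_triangle_def convex_hull_3 by blast
  then have x: "x = u - v" and y: "y = sqrt 3 * w" and "0 \<le> u" "0 \<le> v" "0 \<le> w" "w = 1 - u - v"
    by auto
  then show "0 \<le> y" "y \<le> sqrt 3 * (1 + x)" "y \<le> sqrt 3 * (1 - x)"
    by (auto intro!: mult_left_mono)
qed

lemma infdist_flat_set:
  fixes Q n :: "'a::real_inner"
  assumes "norm n = 1" and "\<And>p. p \<in> S \<Longrightarrow> n \<bullet> p = c"
    and "0 \<le> d" and "n \<bullet> Q - c = d" and "Q - d *\<^sub>R n \<in> S"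
  shows "infdist Q S = d"
proof (rule antisym)
  have "infdist Q S \<le> dist Q (Q - d *\<^sub>R n)"
    using assms(5) by (rule infdist_le)
  then show "infdist Q S \<le> d"
    using assms(1,3) by (simp add: dist_norm)
  have "d \<le> dist Q p" if "p \<in> S" for p
  proof -
    have "d = n \<bullet> (Q - p)" using assms(2)[OF that] assms(4) by (simp add: inner_diff_right)
    also have "\<dots> \<le> norm n * norm (Q - p)" by (rule norm_cauchy_schwarz)
    finally show ?thesis using assms(1) by (simp add: dist_norm)
  qed
  then show "d \<le> infdist Q S"
    using assms(5) unfolding infdist_def by (auto intro!: cINF_greatest)
qed

lemma piece_alpha_eq:
  assumes "(x, y) \<in> stick_triangle"
  shows "piece_alpha (x, y) = y"
proof -
  note T = stick_triangle_ineqs[OF assms]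
  have "0 \<le> sqrt 3 * (1 + x)" "0 \<le> sqrt 3 * (1 - x)" using T by linarith+
  then have "-1 \<le> x" "x \<le> 1" by (simp_all add: zero_le_mult_iff)
  show ?thesis unfolding piece_alpha_def
  proof (rule infdist_flat_set[where n = "(0, 1)" and c = 0])
    show "(x, y) - y *\<^sub>R (0, 1) \<in> closed_segment (-1, 0) (1, 0)"
      unfolding in_segment using \<open>-1 \<le> x\<close> \<open>x \<le> 1\<close>
      by (intro exI[of _ "(1 + x) / 2"]) (auto simp: field_simps)
  qed (use T in \<open>auto simp: in_segment norm_Pair\<close>)
qed

lemma piece_beta_eq:
  assumes "(x, y) \<in> stick_triangle"
  shows "piece_beta (x, y) = (sqrt 3 * (1 + x) - y) / 2"
proof -
  note T = stick_triangle_ineqs[OF assms]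
  have s: "sqrt 3 * (sqrt 3 * z) = 3 * z" for z :: real by simp
  have "sqrt 3 * y \<le> sqrt 3 * (sqrt 3 * (1 + x))" "sqrt 3 * y \<le> sqrt 3 * (sqrt 3 * (1 - x))"
    "0 \<le> sqrt 3 * y"
    using T by (auto intro!: mult_left_mono)
  then have b: "sqrt 3 * y \<le> 3 * (1 + x)" "sqrt 3 * y \<le> 3 * (1 - x)" "0 \<le> sqrt 3 * y"
    unfolding s by auto
  show ?thesis unfolding piece_beta_def
  proof (rule infdist_flat_set[where n = "(sqrt 3 / 2, - 1 / 2)" and c = "- sqrt 3 / 2"])
    show "(x, y) - ((sqrt 3 * (1 + x) - y) / 2) *\<^sub>R (sqrt 3 / 2, - 1 / 2)
        \<in> closed_segment (-1, 0) (0, sqrt 3)"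
      unfolding in_segment using b
      by (intro exI[of _ "(1 + x + sqrt 3 * y) / 4"]) (auto simp: field_simps)
  qed (use T in \<open>auto simp: in_segment norm_Pair field_simps\<close>)
qed

lemma piece_gamma_eq:
  assumes "(x, y) \<in> stick_triangle"
  shows "piece_gamma (x, y) = (sqrt 3 * (1 - x) - y) / 2"
proof -
  note T = stick_triangle_ineqs[OF assms]
  have s: "sqrt 3 * (sqrt 3 * z) = 3 * z" for z :: real by simp
  have "sqrt 3 * y \<le> sqrt 3 * (sqrt 3 * (1 + x))" "sqrt 3 * y \<le> sqrt 3 * (sqrt 3 * (1 - x))"
    "0 \<le> sqrt 3 * y"
    using T by (auto intro!: mult_left_mono)
  then have b: "sqrt 3 * y \<le> 3 * (1 + x)" "sqrt 3 * y \<le> 3 * (1 - x)" "0 \<le> sqrt 3 * y"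
    unfolding s by auto
  show ?thesis unfolding piece_gamma_def
  proof (rule infdist_flat_set[where n = "(- sqrt 3 / 2, - 1 / 2)" and c = "- sqrt 3 / 2"])
    show "(x, y) - ((sqrt 3 * (1 - x) - y) / 2) *\<^sub>R (- sqrt 3 / 2, - 1 / 2)
        \<in> closed_segment (1, 0) (0, sqrt 3)"
      unfolding in_segment using b
      by (intro exI[of _ "(1 - x + sqrt 3 * y) / 4"]) (auto simp: field_simps)
  qed (use T in \<open>auto simp: in_segment norm_Pair field_simps\<close>)
qed

end

theory Submission
  imports Defs
begin

text \<open>
  By the law of cosines, an acute triangle with sides \<open>a\<close>, \<open>b\<close>, \<open>c\<close> exists exactly when each of
  \<open>a\<^sup>2\<close>, \<open>b\<^sup>2\<close>, \<open>c\<^sup>2\<close> is less than the sum of the other two: the existence of some triangle comes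
  for free, because \<open>a\<^sup>2 < b\<^sup>2 + c\<^sup>2\<close> implies \<open>a < b + c\<close>. This is
  \<open>exists_acute_triangle_iff\<close>.

  Measure heights in units of \<open>sqrt 3\<close>, that is, put \<open>y = sqrt 3 * t\<close>. The pieces become
  \<open>sqrt 3\<close> times \<open>t\<close>, \<open>(1 - t + x) / 2\<close>, \<open>(1 - t - x) / 2\<close>. The angle opposite to \<open>\<alpha>\<close> is acute when
  \<open>(t + 1)\<^sup>2 - 2 < x\<^sup>2\<close>, and the other two are acute when \<open>\<bar>x\<bar> < t\<^sup>2 / (1 - t)\<close>. So the favourable
  region lies between branches of three hyperbolas whose arcs end on the line \<open>t = 1 / 2\<close>, above
  which there is no triangle since \<open>\<alpha>\<close> would exceed half of the stick; this is
  \<open>acute_region_iff\<close>.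

  The horizontal line at height \<open>t \<le> 1 / 2\<close> therefore meets the region in length
  \<open>2 * (t\<^sup>2 / (1 - t) - g t)\<close>, where \<open>g t\<close> is \<open>sqrt ((t + 1)\<^sup>2 - 2)\<close> for \<open>t \<ge> sqrt 2 - 1\<close> and \<open>0\<close>
  below. The two terms have elementary integrals, \<open>ln 2 - 5 / 8\<close> and \<open>3 / 8 - ln 2 / 2\<close>, so the region
  has area \<open>sqrt 3 * (3 * ln 2 - 2)\<close>. The whole triangle has area \<open>sqrt 3\<close>.
\<close>

section \<open>Acute triangles\<close>

lemma law_of_cosines:
  fixes A B C :: "'a::real_inner"
  shows "2 * ((A - B) \<bullet> (C - B)) = (dist A B)\<^sup>2 + (dist C B)\<^sup>2 - (dist A C)\<^sup>2"
  by (simp add: dist_norm power2_norm_eq_inner inner_diff inner_commute)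

text \<open>
  When a leg vanishes the cosine is \<open>0 / 0 = 0\<close>, which counts as a right angle, and the right-hand
  side fails as well; hence the vertices may coincide.
\<close>

lemma angle_less_right_iff:
  fixes A B C :: "'a::real_inner"
  shows "angle_at B A C < pi / 2 \<longleftrightarrow> (dist A C)\<^sup>2 < (dist A B)\<^sup>2 + (dist B C)\<^sup>2"
proof -
  define p where "p = (A - B) \<bullet> (C - B)"
  define n where "n = norm (A - B) * norm (C - B)"
  have "\<bar>p\<bar> \<le> n" "0 \<le> n"
    unfolding p_def n_def by (auto intro: Cauchy_Schwarz_ineq2)
  then have range: "\<bar>p / n\<bar> \<le> 1" and sgn: "0 < p / n \<longleftrightarrow> 0 < p"
    by (auto simp: divide_le_eq zero_less_divide_iff)
  have "arccos (p / n) < arccos 0 \<longleftrightarrow> 0 < p / n"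
    using range by (intro arccos_less_mono) auto
  then have "angle_at B A C < pi / 2 \<longleftrightarrow> 0 < p"
    using sgn by (simp add: angle_at_def p_def n_def)
  then show ?thesis
    using law_of_cosines[of A B C] by (auto simp: p_def dist_commute)
qed

text \<open>Excludes degenerate triangles: collinear vertices make one side the sum of the other two.\<close>

lemma power2_less_sum_imp_ne_add:
  fixes a b c :: real
  assumes "0 \<le> b" "0 \<le> c" "a\<^sup>2 < b\<^sup>2 + c\<^sup>2"
  shows "a \<noteq> b + c"
proof
  assume "a = b + c"
  then have "a\<^sup>2 = b\<^sup>2 + c\<^sup>2 + 2 * (b * c)" by (simp add: power2_sum)
  with assms mult_nonneg_nonneg[of b c] show False by linarith
qed

lemma acute_triangle_iff:
  "acute_triangle A B C \<longleftrightarrow>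
     (dist B C)\<^sup>2 < (dist C A)\<^sup>2 + (dist A B)\<^sup>2 \<and>
     (dist C A)\<^sup>2 < (dist A B)\<^sup>2 + (dist B C)\<^sup>2 \<and>
     (dist A B)\<^sup>2 < (dist B C)\<^sup>2 + (dist C A)\<^sup>2" (is "_ \<longleftrightarrow> ?sq")
proof -
  have "\<not> collinear {A, B, C}" if ?sq
  proof
    assume "collinear {A, B, C}"
    then consider "dist B C = dist C A + dist A B" | "dist C A = dist A B + dist B C"
      | "dist A B = dist B C + dist C A"
      unfolding collinear_between_cases between by (auto simp: dist_commute add.commute)
    then show False
      by cases (use that in \<open>auto dest: power2_less_sum_imp_ne_add[rotated 2]\<close>)
  qed
  then show ?thesis
    unfolding acute_triangle_def angle_less_right_iff by (auto simp: dist_commute add.commute)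
qed

text \<open>
  Put \<open>B\<close> at the origin and \<open>C\<close> at \<open>(a, 0)\<close>. The law of cosines forces the abscissa \<open>p\<close> of \<open>A\<close>, and
  the triangle inequalities amount to \<open>\<bar>p\<bar> \<le> c\<close>, which leaves room for its height.
\<close>

lemma exists_triangle_with_sides:
  fixes a b c :: real
  assumes "0 < a" "0 < b" "0 < c" "a < b + c" "b < a + c" "c < a + b"
  shows "\<exists>A B C :: real \<times> real. dist B C = a \<and> dist C A = b \<and> dist A B = c"
proof -
  define p where "p = (a\<^sup>2 + c\<^sup>2 - b\<^sup>2) / (2 * a)"
  have p: "2 * a * p = a\<^sup>2 + c\<^sup>2 - b\<^sup>2"
    using assms by (simp add: p_def)
  have "\<bar>a - c\<bar> \<le> b" "b \<le> a + c"
    using assms by auto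
  then have "(a - c)\<^sup>2 \<le> b\<^sup>2" "b\<^sup>2 \<le> (a + c)\<^sup>2"
    using assms abs_le_square_iff[of "a - c" b] by (simp_all add: power_mono)
  then have "2 * a * p \<le> 2 * a * c" "2 * a * (- c) \<le> 2 * a * p"
    unfolding p by (auto simp: power2_sum power2_diff)
  then have "p \<le> c" "- c \<le> p"
    unfolding mult_le_cancel_left using assms by auto
  then have "\<bar>p\<bar> \<le> c" by simp
  then have q: "0 \<le> c\<^sup>2 - p\<^sup>2"
    using abs_le_square_iff[of p c] assms by auto
  have "(a - p)\<^sup>2 + (c\<^sup>2 - p\<^sup>2) = b\<^sup>2"
    using p by (simp add: power2_diff)
  then have "dist (0, 0) (a, 0) = a \<and> dist (a, 0) (p, sqrt (c\<^sup>2 - p\<^sup>2)) = b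
      \<and> dist (p, sqrt (c\<^sup>2 - p\<^sup>2)) (0, 0) = c"
    using q assms by (simp add: dist_Pair_Pair dist_real_def)
  then show ?thesis by blast
qed

lemma exists_acute_triangle_iff:
  assumes "0 \<le> a" "0 \<le> b" "0 \<le> c"
  shows "exists_acute_triangle a b c \<longleftrightarrow>
    a\<^sup>2 < b\<^sup>2 + c\<^sup>2 \<and> b\<^sup>2 < c\<^sup>2 + a\<^sup>2 \<and> c\<^sup>2 < a\<^sup>2 + b\<^sup>2"
proof
  assume "exists_acute_triangle a b c"
  then show "a\<^sup>2 < b\<^sup>2 + c\<^sup>2 \<and> b\<^sup>2 < c\<^sup>2 + a\<^sup>2 \<and> c\<^sup>2 < a\<^sup>2 + b\<^sup>2"
    unfolding exists_acute_triangle_def acute_triangle_iff by blast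
next
  assume sq: "a\<^sup>2 < b\<^sup>2 + c\<^sup>2 \<and> b\<^sup>2 < c\<^sup>2 + a\<^sup>2 \<and> c\<^sup>2 < a\<^sup>2 + b\<^sup>2"
  then have "a \<noteq> 0" "b \<noteq> 0" "c \<noteq> 0" by auto
  with assms have pos: "0 < a" "0 < b" "0 < c" by auto
  have tri: "u < v + w" if "0 < v" "0 < w" "u\<^sup>2 < v\<^sup>2 + w\<^sup>2" for u v w :: real
  proof (rule power2_less_imp_less)
    have "(v + w)\<^sup>2 = v\<^sup>2 + w\<^sup>2 + 2 * (v * w)" by (simp add: power2_sum)
    with that mult_pos_pos[OF that(1,2)] show "u\<^sup>2 < (v + w)\<^sup>2" by linarith
  qed (use that in simp)
  have "a < b + c" "b < a + c" "c < a + b"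
    using sq pos tri[of b c a] tri[of c a b] tri[of a b c] by auto
  then obtain A B C :: "real \<times> real" where "dist B C = a" "dist C A = b" "dist A B = c"
    using exists_triangle_with_sides pos by blast
  with sq show "exists_acute_triangle a b c"
    unfolding exists_acute_triangle_def acute_triangle_iff by blast
qed

section \<open>The sample points giving acute triangles\<close>

lemma stick_triangle_iff:
  "(x, y) \<in> stick_triangle \<longleftrightarrow> 0 \<le> y \<and> \<bar>x\<bar> \<le> 1 - y / sqrt 3"
proof
  assume "(x, y) \<in> stick_triangle"
  note stick_triangle_ineqs[OF this]
  then show "0 \<le> y \<and> \<bar>x\<bar> \<le> 1 - y / sqrt 3"
    by (auto simp: field_simps abs_le_iff)
next
  assume *: "0 \<le> y \<and> \<bar>x\<bar> \<le> 1 - y / sqrt 3"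
  \<comment> \<open>The barycentric coordinates are the distances to the sides, divided by \<open>sqrt 3\<close>.\<close>
  define t where "t = y / sqrt 3"
  have "(x, y) = ((1 - t + x) / 2) *\<^sub>R (1, 0) + ((1 - t - x) / 2) *\<^sub>R (-1, 0) + t *\<^sub>R (0, sqrt 3)"
    by (simp add: t_def field_simps)
  moreover have "0 \<le> (1 - t + x) / 2" "0 \<le> (1 - t - x) / 2" "0 \<le> t"
    using * by (auto simp: abs_le_iff simp flip: t_def) (simp add: t_def)
  moreover have "(1 - t + x) / 2 + (1 - t - x) / 2 + t = 1"
    by (simp add: field_simps)
  ultimately show "(x, y) \<in> stick_triangle"
    unfolding stick_triangle_def convex_hull_3 by blast
qed

text \<open>
  With \<open>\<beta>, \<gamma> = sqrt 3 * (1 - t \<plusminus> x) / 2\<close> one has \<open>\<beta>\<^sup>2 + \<gamma>\<^sup>2 = 3 * ((1 - t)\<^sup>2 + x\<^sup>2) / 2\<close> and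
  \<open>\<beta>\<^sup>2 - \<gamma>\<^sup>2 = 3 * x * (1 - t)\<close>. The first identity turns \<open>\<alpha>\<^sup>2 < \<beta>\<^sup>2 + \<gamma>\<^sup>2\<close> into the first inequality
  below; the second turns the other two conditions into the second inequality.
\<close>

lemma exists_acute_triangle_pieces_iff:
  assumes "(x, sqrt 3 * t) \<in> stick_triangle"
  shows "exists_acute_triangle (piece_alpha (x, sqrt 3 * t)) (piece_beta (x, sqrt 3 * t))
      (piece_gamma (x, sqrt 3 * t)) \<longleftrightarrow>
    (t + 1)\<^sup>2 - 2 < x\<^sup>2 \<and> \<bar>x\<bar> * (1 - t) < t\<^sup>2"
proof -
  note T = stick_triangle_ineqs[OF assms]
  have pieces: "piece_alpha (x, sqrt 3 * t) = sqrt 3 * t"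
    "piece_beta (x, sqrt 3 * t) = sqrt 3 * ((1 - t + x) / 2)"
    "piece_gamma (x, sqrt 3 * t) = sqrt 3 * ((1 - t - x) / 2)"
    using assms by (simp_all add: piece_alpha_eq piece_beta_eq piece_gamma_eq algebra_simps)
  have nn: "0 \<le> sqrt 3 * t" "0 \<le> sqrt 3 * ((1 - t + x) / 2)" "0 \<le> sqrt 3 * ((1 - t - x) / 2)"
    using T by (simp_all add: algebra_simps)
  have "0 \<le> 1 - t" using nn by (simp add: zero_le_mult_iff)
  then have "\<bar>x\<bar> * (1 - t) = \<bar>x * (1 - t)\<bar>"
    by (simp add: abs_mult)
  then have "\<bar>x\<bar> * (1 - t) < t\<^sup>2 \<longleftrightarrow> x * (1 - t) < t\<^sup>2 \<and> - (x * (1 - t)) < t\<^sup>2"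
    by (simp only: abs_less_iff)
  then show ?thesis
    unfolding pieces exists_acute_triangle_iff[OF nn]
    by (simp add: power2_eq_square field_simps) (auto simp: algebra_simps)
qed

definition acute_region :: "(real \<times> real) set" where
  "acute_region = {Q \<in> stick_triangle.
     exists_acute_triangle (piece_alpha Q) (piece_beta Q) (piece_gamma Q)}"

text \<open>
  For \<open>t \<le> 1 / 2\<close> the bound \<open>\<bar>x\<bar> \<le> 1 - t\<close> that defines the triangle is implied by
  \<open>\<bar>x\<bar> < t\<^sup>2 / (1 - t)\<close>, so each slice is described by the two hyperbola conditions alone. Conversely,
  \<open>(t + 1)\<^sup>2 - 2 < x\<^sup>2 \<le> (1 - t)\<^sup>2\<close> gives \<open>t < 1 / 2\<close>.
\<close>

lemma acute_region_iff:
  "(x, sqrt 3 * t) \<in> acute_region \<longleftrightarrow>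
    0 \<le> t \<and> t \<le> 1 / 2 \<and> (t + 1)\<^sup>2 - 2 < x\<^sup>2 \<and> \<bar>x\<bar> < t\<^sup>2 / (1 - t)"
    (is "_ \<longleftrightarrow> ?rhs")
proof
  assume "(x, sqrt 3 * t) \<in> acute_region"
  then have T: "0 \<le> t" "\<bar>x\<bar> \<le> 1 - t"
    and ineq: "(t + 1)\<^sup>2 - 2 < x\<^sup>2" "\<bar>x\<bar> * (1 - t) < t\<^sup>2"
    using exists_acute_triangle_pieces_iff[of x t]
    by (auto simp: acute_region_def stick_triangle_iff zero_le_mult_iff)
  have "x\<^sup>2 \<le> (1 - t)\<^sup>2"
    using T abs_le_square_iff[of x "1 - t"] by auto
  with ineq(1) have "t \<le> 1 / 2"
    by (simp add: power2_eq_square algebra_simps)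
  with T ineq show ?rhs by (simp add: pos_less_divide_eq)
next
  assume R: ?rhs
  then have "t < 1" by auto
  with R have "\<bar>x\<bar> * (1 - t) < t\<^sup>2" by (simp add: pos_less_divide_eq)
  moreover have "t\<^sup>2 \<le> (1 - t) * (1 - t)"
    using R by (simp add: power2_eq_square algebra_simps)
  then have "\<bar>x\<bar> * (1 - t) \<le> (1 - t) * (1 - t)"
    using calculation by linarith
  then have "\<bar>x\<bar> \<le> 1 - t" using R by simp
  ultimately show "(x, sqrt 3 * t) \<in> acute_region"
    using R exists_acute_triangle_pieces_iff[of x t]
    by (simp add: acute_region_def stick_triangle_iff)
qed

lemma sets_stick_triangle: "stick_triangle \<in> sets borel"
  unfolding stick_triangle_def
  by (intro borel_compact finite_imp_compact_convex_hull) simp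

lemma sets_acute_region: "acute_region \<in> sets borel"
proof -
  have "acute_region = {Q. 0 \<le> snd Q / sqrt 3 \<and> snd Q / sqrt 3 \<le> 1 / 2
      \<and> (snd Q / sqrt 3 + 1)\<^sup>2 - 2 < (fst Q)\<^sup>2
      \<and> \<bar>fst Q\<bar> < (snd Q / sqrt 3)\<^sup>2 / (1 - snd Q / sqrt 3)}"
    using acute_region_iff[of "fst Q" "snd Q / sqrt 3" for Q] by auto
  moreover have "Measurable.pred (borel \<Otimes>\<^sub>M borel) (\<lambda>Q. 0 \<le> snd Q / sqrt 3 \<and> snd Q / sqrt 3 \<le> 1 / 2
      \<and> (snd Q / sqrt 3 + 1)\<^sup>2 - 2 < (fst Q)\<^sup>2
      \<and> \<bar>fst Q\<bar> < (snd Q / sqrt 3)\<^sup>2 / (1 - snd Q / sqrt 3))"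
    by measurable
  ultimately show ?thesis
    by (simp add: pred_def borel_prod)
qed

section \<open>Areas by horizontal slices\<close>

text \<open>
  Cavalieri's principle with the heights rescaled by \<open>c\<close>, which for \<open>c = sqrt 3\<close> keeps the square
  roots out of the slice lengths.
\<close>

lemma emeasure_lborel_hslices:
  fixes A :: "(real \<times> real) set"
  assumes A: "A \<in> sets borel"
    and slice: "\<And>t. 0 \<le> t \<Longrightarrow> t \<le> m \<Longrightarrow> emeasure lborel {x. (x, c * t) \<in> A} = ennreal (l t)"
    and outside: "\<And>x t. (x, c * t) \<in> A \<Longrightarrow> 0 \<le> t \<and> t \<le> m"
    and nonneg: "\<And>t. 0 \<le> t \<Longrightarrow> t \<le> m \<Longrightarrow> 0 \<le> l t"
    and int: "(l has_integral I) {0..m}"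
    and c: "0 < c"
  shows "emeasure lborel A = ennreal (c * I)"
proof -
  have scaled: "((\<lambda>y. l (y / c)) has_integral c * I) {0..c * m}"
    using has_integral_stretch_real[OF int, of "1 / c"] c
    by (simp add: mult.commute[of _ c] image_mult_atLeastAtMost)
  have slice': "emeasure lborel ((\<lambda>x. (x, y)) -` A) = ennreal (l (y / c)) * indicator {0..c * m} y" for y
  proof (cases "y \<in> {0..c * m}")
    case True
    then show ?thesis
      using slice[of "y / c"] c by (simp add: vimage_def field_simps)
  next
    case False
    then have "(\<lambda>x. (x, y)) -` A = {}"
      using outside[of _ "y / c"] c by (auto simp: field_simps)
    with False show ?thesis by simp
  qed
  have "A \<in> sets (lborel \<Otimes>\<^sub>M lborel)"
    unfolding lborel_prod using A by simp
  then have "emeasure (lborel \<Otimes>\<^sub>M lborel) A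
      = (\<integral>\<^sup>+y. ennreal (l (y / c)) * indicator {0..c * m} y \<partial>lborel)"
    using lborel_pair.emeasure_pair_measure_alt2[of A] by (simp only: slice')
  also have "\<dots> = ennreal (c * I)"
    using c nonneg by (intro nn_integral_has_integral_lebesgue'[OF _ scaled]) (auto simp: field_simps)
  finally show ?thesis by (simp add: lborel_prod)
qed

section \<open>Integrals of the bounding curves\<close>

lemma has_integral_outer_arc:
  "((\<lambda>t. t\<^sup>2 / (1 - t)) has_integral ln 2 - 5 / 8) {0..1 / 2 :: real}"
proof -
  define F where "F t = - t\<^sup>2 / 2 - t - ln (1 - t)" for t :: real
  have "((\<lambda>t. t\<^sup>2 / (1 - t)) has_integral F (1 / 2) - F 0) {0..1 / 2}"
  proof (rule fundamental_theorem_of_calculus)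
    fix t :: real assume "t \<in> {0..1 / 2}"
    then show "(F has_vector_derivative t\<^sup>2 / (1 - t)) (at t within {0..1 / 2})"
      unfolding F_def has_real_derivative_iff_has_vector_derivative[symmetric]
      by (auto intro!: derivative_eq_intros simp: field_simps power2_eq_square)
  qed simp
  moreover have "F (1 / 2) - F 0 = ln 2 - 5 / 8"
    by (simp add: F_def ln_div power2_eq_square)
  ultimately show ?thesis by simp
qed

text \<open>
  With \<open>s = t + 1\<close> and \<open>q = sqrt (s\<^sup>2 - 2)\<close>, an antiderivative of \<open>q\<close> is \<open>s * q / 2 - ln (s + q)\<close>. As
  \<open>q\<close> is not differentiable at the lower limit, where it vanishes, the fundamental theorem is used
  in the form that requires the derivative only in the interior.
\<close>

lemma has_integral_inner_arc:
  "((\<lambda>t. sqrt ((t + 1)\<^sup>2 - 2)) has_integral 3 / 8 - ln 2 / 2) {sqrt 2 - 1..1 / 2 :: real}"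
proof -
  define r where "r t = sqrt ((t + 1)\<^sup>2 - 2)" for t :: real
  define F where "F t = (t + 1) * r t / 2 - ln (t + 1 + r t)" for t
  have le: "sqrt 2 - 1 \<le> 1 / 2"
    using real_le_lsqrt[of "3 / 2" 2] by (simp add: power2_eq_square)
  have pos: "0 < t + 1 + r t" if "sqrt 2 - 1 \<le> t" for t
  proof -
    have "sqrt 2 \<le> t + 1" using that by simp
    then have "2 \<le> (t + 1)\<^sup>2" using sqrt_le_D by blast
    then have "0 \<le> r t" by (simp add: r_def)
    moreover have "0 < sqrt 2" by simp
    ultimately show ?thesis using that by linarith
  qed
  have "(r has_integral F (1 / 2) - F (sqrt 2 - 1)) {sqrt 2 - 1..1 / 2}"
  proof (rule fundamental_theorem_of_calculus_interior[OF le])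
    show "continuous_on {sqrt 2 - 1..1 / 2} F"
      unfolding F_def r_def
      by (intro continuous_intros) (use pos in \<open>force simp: r_def\<close>)+
  next
    fix t assume t: "t \<in> {sqrt 2 - 1<..<1 / 2}"
    then have "(sqrt 2)\<^sup>2 < (t + 1)\<^sup>2" by (intro power_strict_mono) auto
    then have gt: "2 < (t + 1)\<^sup>2" by simp
    define s where "s = t + 1"
    define q where "q = r t"
    have q: "0 < q" "q\<^sup>2 = s\<^sup>2 - 2"
      using gt by (simp_all add: q_def r_def s_def)
    have sq: "0 < s + q" using pos[of t] t by (simp add: s_def q_def)
    have r': "(r has_real_derivative s / q) (at t)"
      unfolding r_def s_def q_def using gt
      by (auto intro!: derivative_eq_intros simp: field_simps)
    have "(F has_real_derivative (q + s * (s / q)) / 2 - (1 + s / q) / (s + q)) (at t)"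
      unfolding F_def using pos[of t] t
      by (auto intro!: derivative_eq_intros r' simp: s_def q_def)
    also have "(1 + s / q) / (s + q) = 1 / q"
    proof -
      have "1 + s / q = (s + q) / q" using q by (simp add: field_simps)
      then show ?thesis using sq by simp
    qed
    also have "(q + s * (s / q)) / 2 - 1 / q = q"
    proof -
      have "s * (s / q) = (q * q + 2) / q" using q(2) by (simp add: power2_eq_square)
      then show ?thesis using q(1) by (simp add: field_simps)
    qed
    finally show "(F has_vector_derivative r t) (at t)"
      by (simp add: q_def has_real_derivative_iff_has_vector_derivative)
  qed
  moreover have "F (1 / 2) - F (sqrt 2 - 1) = 3 / 8 - ln 2 / 2"
  proof -
    have "r (1 / 2) = 1 / 2" "r (sqrt 2 - 1) = 0"
      by (auto simp: r_def power2_eq_square real_sqrt_divide)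
    then show ?thesis unfolding F_def by (simp only:) (simp add: ln_sqrt)
  qed
  ultimately show ?thesis by (simp add: r_def[abs_def])
qed

section \<open>Areas of the triangle and of the acute region\<close>

lemma emeasure_stick_triangle: "emeasure lborel stick_triangle = ennreal (sqrt 3)"
proof -
  have "((\<lambda>t. 2 * (1 - t)) has_integral (2 * 1 - 1\<^sup>2) - (2 * 0 - 0\<^sup>2)) {0..1 :: real}"
    by (intro fundamental_theorem_of_calculus)
      (auto intro!: derivative_eq_intros simp: has_real_derivative_iff_has_vector_derivative[symmetric])
  then have int: "((\<lambda>t. 2 * (1 - t)) has_integral 1) {0..1 :: real}" by simp
  have "emeasure lborel stick_triangle = ennreal (sqrt 3 * 1)"
  proof (rule emeasure_lborel_hslices[OF sets_stick_triangle _ _ _ int])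
    fix t :: real assume t: "0 \<le> t" "t \<le> 1"
    then have "{x. (x, sqrt 3 * t) \<in> stick_triangle} = {- (1 - t)..1 - t}"
      by (auto simp: stick_triangle_iff)
    with t show "emeasure lborel {x. (x, sqrt 3 * t) \<in> stick_triangle} = ennreal (2 * (1 - t))"
      by simp
  qed (auto simp: stick_triangle_iff zero_le_mult_iff)
  then show ?thesis by simp
qed

lemma emeasure_acute_region: "emeasure lborel acute_region = ennreal (sqrt 3 * (3 * ln 2 - 2))"
proof (rule emeasure_lborel_hslices[OF sets_acute_region])
  define f where "f t = t\<^sup>2 / (1 - t)" for t :: real
  \<comment> \<open>The slice at height \<open>t\<close> is \<open>g t < \<bar>x\<bar> < f t\<close>, together with \<open>x = 0\<close> when \<open>0 < t < sqrt 2 - 1\<close>.\<close>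
  define g where "g t = (if t < sqrt 2 - 1 then 0 else sqrt ((t + 1)\<^sup>2 - 2))" for t
  have thr: "(t + 1)\<^sup>2 < 2 \<longleftrightarrow> t < sqrt 2 - 1" if "0 \<le> t" for t
    using real_less_rsqrt[of "t + 1" 2] real_sqrt_less_iff[of "(t + 1)\<^sup>2" 2] that by auto
  show "((\<lambda>t. 2 * (f t - g t)) has_integral 3 * ln 2 - 2) {0..1 / 2}"
  proof -
    have "1 \<le> sqrt 2" "sqrt 2 \<le> 3 / 2"
      using real_le_lsqrt[of "3 / 2" 2] by (simp_all add: power2_eq_square)
    moreover have "(g has_integral 0) {0..sqrt 2 - 1}"
      by (rule has_integral_spike_finite[of "{sqrt 2 - 1}" _ _ "\<lambda>_. 0"]) (auto simp: g_def)
    moreover have "(g has_integral 3 / 8 - ln 2 / 2) {sqrt 2 - 1..1 / 2}"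
      by (rule has_integral_eq[OF _ has_integral_inner_arc]) (simp add: g_def)
    ultimately have "(g has_integral 0 + (3 / 8 - ln 2 / 2)) {0..1 / 2}"
      by (intro has_integral_combine[where c = "sqrt 2 - 1"]) auto
    from has_integral_mult_right[OF has_integral_diff[OF has_integral_outer_arc this], of 2]
    show ?thesis by (simp add: f_def algebra_simps)
  qed
  have gf: "0 \<le> g t" "g t \<le> f t" if t: "0 \<le> t" "t \<le> 1 / 2" for t
  proof -
    have f0: "0 \<le> f t" using t by (simp add: f_def)
    \<comment> \<open>Why the outer arc stays outside the inner one: the gap between the squares is a square.\<close>
    have "(f t)\<^sup>2 - ((t + 1)\<^sup>2 - 2) = ((1 - 2 * t) / (1 - t))\<^sup>2"
    proof -
      have "1 - t \<noteq> 0" using t by simp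
      moreover have "(t\<^sup>2)\<^sup>2 - ((t + 1)\<^sup>2 - 2) * (1 - t)\<^sup>2 = (1 - 2 * t)\<^sup>2"
        by (simp add: power2_eq_square algebra_simps)
      ultimately show ?thesis
        unfolding f_def power_divide by (simp add: divide_diff_eq_iff)
    qed
    then have "(t + 1)\<^sup>2 - 2 \<le> (f t)\<^sup>2"
      by (smt (verit) zero_le_power2)
    with f0 show "g t \<le> f t" by (auto simp: g_def intro: real_le_lsqrt)
    show "0 \<le> g t" using thr[OF t(1)] by (auto simp: g_def)
  qed
  then show "0 \<le> 2 * (f t - g t)" if "0 \<le> t" "t \<le> 1 / 2" for t
    using that by simp
  fix t :: real assume t: "0 \<le> t" "t \<le> 1 / 2"
  \<comment> \<open>The \<open>x\<close> for which \<open>\<alpha>\<^sup>2 \<ge> \<beta>\<^sup>2 + \<gamma>\<^sup>2\<close>.\<close>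
  define J where "J = (if t < sqrt 2 - 1 then {} else {- g t..g t})"
  have J: "x \<notin> J \<longleftrightarrow> (t + 1)\<^sup>2 - 2 < x\<^sup>2" for x
  proof (cases "t < sqrt 2 - 1")
    case True
    then have "(t + 1)\<^sup>2 < 2" using thr[OF t(1)] by simp
    then have "(t + 1)\<^sup>2 - 2 < x\<^sup>2" by (smt (verit) zero_le_power2)
    with True show ?thesis by (simp add: J_def)
  next
    case False
    then have "2 \<le> (t + 1)\<^sup>2" using thr[OF t(1)] by simp
    then have "\<bar>x\<bar> \<le> g t \<longleftrightarrow> x\<^sup>2 \<le> (t + 1)\<^sup>2 - 2"
      using False abs_le_square_iff[of x "g t"] gf(1)[OF t] by (simp add: g_def)
    with False show ?thesis by (auto simp: J_def abs_le_iff)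
  qed
  have "{x. (x, sqrt 3 * t) \<in> acute_region} = {- f t<..<f t} - J"
    using t J by (auto simp: acute_region_iff f_def abs_less_iff)
  moreover have "emeasure lborel ({- f t<..<f t} - J) = ennreal (2 * (f t - g t))"
  proof (cases "t < sqrt 2 - 1")
    case True
    with gf[OF t] show ?thesis by (simp add: J_def g_def)
  next
    case False
    then have "{- f t<..<f t} - J = {- f t<..<- g t} \<union> {g t<..<f t}"
      using gf[OF t] by (auto simp: J_def)
    moreover have "emeasure lborel ({- f t<..<- g t} \<union> {g t<..<f t})
        = ennreal (f t - g t) + ennreal (f t - g t)"
      using gf[OF t] by (subst plus_emeasure[symmetric]) auto
    ultimately show ?thesis
      using gf[OF t] by (simp flip: ennreal_plus)
  qed
  ultimately show "emeasure lborel {x. (x, sqrt 3 * t) \<in> acute_region} = ennreal (2 * (f t - g t))"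
    by simp
qed (auto simp: acute_region_iff)

theorem theorem1:
  shows "measure (uniform_measure lborel stick_triangle)
           {Q \<in> stick_triangle.
              exists_acute_triangle (piece_alpha Q) (piece_beta Q) (piece_gamma Q)}
         = ln (8 / (exp 1)\<^sup>2)
       \<and> ln (8 / (exp 1)\<^sup>2) = 3 * ln 2 - (2 :: real)"
proof -
  have ln: "ln (8 / (exp 1)\<^sup>2) = 3 * ln 2 - (2 :: real)"
    using ln_realpow[of 2 3] by (simp add: ln_div ln_realpow)
  \<comment> \<open>Needed since \<open>ennreal\<close> sends negative numbers to \<open>0\<close>.\<close>
  have nonneg: "0 \<le> 3 * ln 2 - (2 :: real)"
    using ln2_ge_two_thirds by simp
  have "stick_triangle \<inter> acute_region = acute_region"
    by (auto simp: acute_region_def)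
  then have "emeasure (uniform_measure lborel stick_triangle) acute_region
      = ennreal (sqrt 3 * (3 * ln 2 - 2)) / ennreal (sqrt 3)"
    by (simp add: emeasure_uniform_measure sets_stick_triangle sets_acute_region
        emeasure_stick_triangle emeasure_acute_region)
  also have "\<dots> = ennreal (3 * ln 2 - 2)"
    using nonneg by (simp add: divide_ennreal)
  finally have "measure (uniform_measure lborel stick_triangle) acute_region = 3 * ln 2 - 2"
    using nonneg by (rule measure_eq_emeasure_eq_ennreal[rotated])
  with ln show ?thesis by (simp add: acute_region_def)
qed

end
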